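(* For $\rho>0$ and $N_{\mathrm{mesh}}\ge1$, put $n=3N_{\mathrm{mesh}}$ and let $\mathbf{K}_n^{(3,0)}(\rho)=-\mathbf{B}_n^{(3,0)}+\rho\,\mathbf{M}_n^{(3,0)}\in\mathbb{R}^{n\times n}$ be the matrix defined in the context. If $$\rho\in(90-2\sqrt{1605},10)\cup(42,60)\cup(90+2\sqrt{1605},+\infty),$$ then the condition numbers of $\mathbf{K}_n^{(3,0)}(\rho)$ grow at least exponentially as $n\to\infty$ (there are $c,\alpha>0$, depending on $\rho$, with $\kappa(\mathbf{K}_n^{(3,0)}(\rho))\ge c\,e^{\alpha n}$ for all $n$). If $$\rho\in(0,90-2\sqrt{1605}]\cup[10,42]\cup[60,90+2\sqrt{1605}],$$ then their growth is at most polynomial (there is $\nu$ with $\kappa(\mathbf{K}_n^{(3,0)}(\rho))=O(n^\nu)$).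
   Context: $\mathbf{M}_n^{(3,0)}$ and $\mathbf{B}_n^{(3,0)}$ are the $3N_{\mathrm{mesh}}\times3N_{\mathrm{mesh}}$ block lower triangular block Toeplitz matrices $(M_{i-j})_{i,j=0}^{N_{\mathrm{mesh}}-1}$ and $(B_{i-j})_{i,j=0}^{N_{\mathrm{mesh}}-1}$ with $3\times3$ blocks $$M_0=\tfrac1{140}\begin{pmatrix}10&4&1\\12&9&4\\9&12&10\end{pmatrix},\ M_1=\tfrac1{140}\begin{pmatrix}4&10&40\\0&0&10\\0&0&4\end{pmatrix},\ M_2=\tfrac1{140}\begin{pmatrix}0&0&1\\0&0&0\\0&0&0\end{pmatrix},$$ $$B_0=\tfrac3{10}\begin{pmatrix}-3&-2&-1\\4&1&-2\\1&4&-3\end{pmatrix},\ B_1=\tfrac3{10}\begin{pmatrix}-2&-3&12\\0&0&-3\\0&0&-2\end{pmatrix},\ B_2=\tfrac3{10}\begin{pmatrix}0&0&-1\\0&0&0\\0&0&0\end{pmatrix},$$ all other blocks being zero. (These are the scaled temporal mass and stiffness matrices of cubic $C^0$ B-splines on a uniform mesh with $N_{\mathrm{mesh}}$ elements.) $\kappa(M)=\|M\|\,\|M^{-1}\|$ in the spectral norm, with $\kappa(M)=\infty$ if $M$ is singular. *)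

theory Defs
  imports Complex_Main "HOL-Library.Extended_Real"
    "Jordan_Normal_Form.Gauss_Jordan_Elimination"
begin

definition vec_norm :: "real vec \<Rightarrow> real" where
  "vec_norm v = sqrt (scalar_prod v v)"

definition spectral_norm :: "real mat \<Rightarrow> real" where
  "spectral_norm A =
     (SUP v \<in> {v \<in> carrier_vec (dim_col A). vec_norm v \<le> 1}. vec_norm (A *\<^sub>v v))"

text \<open>Meant for square matrices, on which \<open>mat_inverse\<close> returns \<open>None\<close> exactly in the singular case.\<close>

definition cond_number :: "real mat \<Rightarrow> ereal" where
  "cond_number A = (case mat_inverse A of
     None \<Rightarrow> \<infinity>
   | Some B \<Rightarrow> ereal (spectral_norm A * spectral_norm B))"

text \<open>The \<open>m * N\<close> by \<open>m * N\<close> matrix whose \<open>m\<close> by \<open>m\<close> block in block position \<open>(i, j)\<close>,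
  \<open>i, j < N\<close>, is \<open>A (i - j)\<close> if \<open>j \<le> i\<close>, and zero otherwise.\<close>

definition block_lower_toeplitz :: "nat \<Rightarrow> (nat \<Rightarrow> real mat) \<Rightarrow> nat \<Rightarrow> real mat" where
  "block_lower_toeplitz m A N = mat (m * N) (m * N) (\<lambda>(i, j).
     if j div m \<le> i div m then A (i div m - j div m) $$ (i mod m, j mod m) else 0)"

definition mass_block :: "nat \<Rightarrow> real mat" where
  "mass_block k =
    (if k = 0 then (1 / 140) \<cdot>\<^sub>m mat_of_rows_list 3
       [[10,  4,  1],
        [12,  9,  4],
        [ 9, 12, 10]]
     else if k = 1 then (1 / 140) \<cdot>\<^sub>m mat_of_rows_list 3
       [[ 4, 10, 40],
        [ 0,  0, 10],
        [ 0,  0,  4]]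
     else if k = 2 then (1 / 140) \<cdot>\<^sub>m mat_of_rows_list 3
       [[ 0,  0,  1],
        [ 0,  0,  0],
        [ 0,  0,  0]]
     else 0\<^sub>m 3 3)"

definition stiffness_block :: "nat \<Rightarrow> real mat" where
  "stiffness_block k =
    (if k = 0 then (3 / 10) \<cdot>\<^sub>m mat_of_rows_list 3
       [[-3, -2, -1],
        [ 4,  1, -2],
        [ 1,  4, -3]]
     else if k = 1 then (3 / 10) \<cdot>\<^sub>m mat_of_rows_list 3
       [[-2, -3, 12],
        [ 0,  0, -3],
        [ 0,  0, -2]]
     else if k = 2 then (3 / 10) \<cdot>\<^sub>m mat_of_rows_list 3
       [[ 0,  0, -1],
        [ 0,  0,  0],
        [ 0,  0,  0]]
     else 0\<^sub>m 3 3)"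

text \<open>In the following definitions the argument \<open>N\<close> is the number of mesh elements;
  the matrices have order \<open>3 * N\<close>.\<close>

definition mass_matrix :: "nat \<Rightarrow> real mat" where
  "mass_matrix N = block_lower_toeplitz 3 mass_block N"

definition stiffness_matrix :: "nat \<Rightarrow> real mat" where
  "stiffness_matrix N = block_lower_toeplitz 3 stiffness_block N"

definition K_matrix :: "nat \<Rightarrow> real \<Rightarrow> real mat" where
  "K_matrix N \<rho> = - stiffness_matrix N + \<rho> \<cdot>\<^sub>m mass_matrix N"

end

theory Submission
  imports Defs "Jordan_Normal_Form.Determinant" "HOL-Computational_Algebra.Polynomial_FPS" "HOL-Analysis.L2_Norm"
begin

text \<open>
  A block lower triangular Toeplitz matrix acts on the generating functions of the block components
  of a vector as multiplication by its symbol \<open>P(z) = \<Sum>k. A\<^sub>k z^k\<close>, truncated after \<open>N\<close> blocks.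
  For the matrices \<open>K_matrix N \<rho>\<close> the symbol is a \<open>3\<close> by \<open>3\<close> matrix of polynomials whose determinant
  is, up to a positive factor, the palindromic quadratic \<open>p + q z + p z^2\<close> with
  \<open>p = K_det_end \<rho> > 0\<close> and \<open>q = K_det_mid \<rho>\<close>. The product of its two roots is \<open>1\<close>, so either both
  lie on the unit circle (\<open>\<bar>q\<bar> \<le> 2 p\<close>), or exactly one lies inside it (\<open>\<bar>q\<bar> > 2 p\<close>). The values of
  the quadratic at \<open>z = 1\<close> and \<open>z = -1\<close> factor explicitly, and the signs of the factors turn this
  alternative into the two sets of \<open>\<rho>\<close> of the theorem.

  If there is a root \<open>r\<close> with \<open>\<bar>r\<bar> < 1\<close>, take a kernel vector \<open>w\<close> of \<open>P(r)\<close> and let \<open>x\<close> have the blocks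
  \<open>r^(N-1-j) w\<close>. All blocks of the image of \<open>x\<close> vanish except the first few, which are of size
  \<open>\<bar>r\<bar>^N\<close>, while the last block of \<open>x\<close> is \<open>w\<close>; hence the inverse, if it exists, has
  exponentially large norm (\<open>block_lower_toeplitz_decaying_image\<close>). A row of cofactors of \<open>P(r)\<close>
  serves as \<open>w\<close>; its last entry is a nonzero constant times \<open>(\<rho> - 10) (\<rho> - 42)\<close>.

  If both roots lie on the unit circle, the power series coefficients of \<open>1 / (p + q z + p z^2)\<close>
  are Chebyshev polynomials of the second kind at a point of \<open>[-1, 1]\<close>, so the \<open>n\<close>-th one is
  \<open>O(n)\<close> (\<open>reciprocal_palindromic_quadratic_coeffs\<close>). Multiplication by the adjugate and by this
  series solves the linear system, with polynomial loss
  (\<open>block_lower_toeplitz_solution_bound\<close>).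
\<close>

section \<open>Norms and condition numbers\<close>

lemma vec_norm_altdef: "vec_norm v = L2_set (\<lambda>i. \<bar>v $ i\<bar>) {..<dim_vec v}"
  by (simp add: vec_norm_def L2_set_def scalar_prod_def power2_eq_square atLeast0LessThan)

lemma vec_norm_nonneg: "0 \<le> vec_norm v"
  by (simp add: vec_norm_altdef)

lemma vec_norm_le_sum_abs: "vec_norm v \<le> (\<Sum>i<dim_vec v. \<bar>v $ i\<bar>)"
  unfolding vec_norm_altdef by (rule L2_set_le_sum) auto

lemma abs_entry_le_vec_norm: "i < dim_vec v \<Longrightarrow> \<bar>v $ i\<bar> \<le> vec_norm v"
  unfolding vec_norm_altdef by (rule member_le_L2_set) auto

lemma vec_norm_smult: "vec_norm (c \<cdot>\<^sub>v v) = \<bar>c\<bar> * vec_norm v"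
  unfolding vec_norm_altdef by (simp add: L2_set_right_distrib abs_mult cong: L2_set_cong_simp)

lemma vec_norm_unit_vec: "i < n \<Longrightarrow> vec_norm (unit_vec n i) = 1"
  by (simp add: vec_norm_def)

lemma member_le_double_sum:
  fixes f :: "nat \<Rightarrow> nat \<Rightarrow> real"
  assumes "i < n" "j < k" and nonneg: "\<And>i j. 0 \<le> f i j"
  shows "f i j \<le> (\<Sum>i<n. \<Sum>j<k. f i j)"
proof -
  have "f i j \<le> (\<Sum>j<k. f i j)"
    using assms by (intro member_le_sum) auto
  also have "\<dots> \<le> (\<Sum>i<n. \<Sum>j<k. f i j)"
    using assms by (intro member_le_sum[where f = "\<lambda>i. \<Sum>j<k. f i j"]) (auto intro: sum_nonneg)
  finally show ?thesis .
qed

lemma vec_norm_mult_mat_vec_le: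
  assumes A: "A \<in> carrier_mat n k" and v: "v \<in> carrier_vec k"
    and E: "\<And>i j. i < n \<Longrightarrow> j < k \<Longrightarrow> \<bar>A $$ (i, j)\<bar> \<le> E"
  shows "vec_norm (A *\<^sub>v v) \<le> real n * real k * E * vec_norm v"
proof -
  have "\<bar>(A *\<^sub>v v) $ i\<bar> \<le> k * E * vec_norm v" if i: "i < n" for i
  proof -
    have "(A *\<^sub>v v) $ i = (\<Sum>j<k. A $$ (i, j) * v $ j)"
      using A v i by (simp add: scalar_prod_def atLeast0LessThan)
    also have "\<bar>\<dots>\<bar> \<le> (\<Sum>j<k. \<bar>A $$ (i, j)\<bar> * \<bar>v $ j\<bar>)"
      by (rule order_trans[OF sum_abs]) (simp add: abs_mult)
    also have "\<dots> \<le> (\<Sum>j<k. E * vec_norm v)"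
    proof (rule sum_mono)
      fix j assume "j \<in> {..<k}"
      then have "\<bar>A $$ (i, j)\<bar> \<le> E" "\<bar>v $ j\<bar> \<le> vec_norm v"
        using i E v abs_entry_le_vec_norm[of j v] by auto
      then show "\<bar>A $$ (i, j)\<bar> * \<bar>v $ j\<bar> \<le> E * vec_norm v"
        by (intro mult_mono) auto
    qed
    finally show ?thesis by simp
  qed
  then have "(\<Sum>i<n. \<bar>(A *\<^sub>v v) $ i\<bar>) \<le> (\<Sum>i<n. k * E * vec_norm v)"
    by (intro sum_mono) auto
  moreover have "vec_norm (A *\<^sub>v v) \<le> (\<Sum>i<n. \<bar>(A *\<^sub>v v) $ i\<bar>)"
    using vec_norm_le_sum_abs[of "A *\<^sub>v v"] A by simp
  ultimately show ?thesis by (simp add: mult.assoc)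
qed

lemma spectral_norm_le:
  assumes A: "A \<in> carrier_mat n n" and E: "\<And>i j. i < n \<Longrightarrow> j < n \<Longrightarrow> \<bar>A $$ (i, j)\<bar> \<le> E"
    and "0 \<le> E"
  shows "spectral_norm A \<le> real n ^ 2 * E"
  unfolding spectral_norm_def
proof (rule cSUP_least)
  show "{v \<in> carrier_vec (dim_col A). vec_norm v \<le> 1} \<noteq> {}"
    by (auto simp: vec_norm_def intro!: exI[of _ "0\<^sub>v (dim_col A)"])
next
  fix v assume v: "v \<in> {v \<in> carrier_vec (dim_col A). vec_norm v \<le> 1}"
  then have "vec_norm (A *\<^sub>v v) \<le> real n * real n * E * vec_norm v"
    using A by (intro vec_norm_mult_mat_vec_le[OF A _ E]) auto
  also have "\<dots> \<le> real n * real n * E * 1"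
    using v \<open>0 \<le> E\<close> by (intro mult_left_mono) auto
  finally show "vec_norm (A *\<^sub>v v) \<le> real n ^ 2 * E" by (simp add: power2_eq_square)
qed

text \<open>The supremum in the definition of the spectral norm is only meaningful because the
  set is bounded above, which the crude entrywise estimate provides. For \<open>v\<close> of norm zero
  that estimate gives the claim directly; otherwise \<open>v\<close> can be normalised.\<close>

lemma vec_norm_mult_le_spectral_norm:
  assumes A: "A \<in> carrier_mat n k" and v: "v \<in> carrier_vec k"
  shows "vec_norm (A *\<^sub>v v) \<le> spectral_norm A * vec_norm v"
proof -
  define E where "E = (\<Sum>i<n. \<Sum>j<k. \<bar>A $$ (i, j)\<bar>)"
  have E: "\<bar>A $$ (i, j)\<bar> \<le> E" if "i < n" "j < k" for i j
    unfolding E_def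
    by (rule member_le_double_sum[where f = "\<lambda>i j. \<bar>A $$ (i, j)\<bar>"]) (use that in auto)
  have E0: "0 \<le> E" by (auto simp: E_def intro: sum_nonneg)
  have bdd: "bdd_above ((\<lambda>v. vec_norm (A *\<^sub>v v)) ` {v \<in> carrier_vec (dim_col A). vec_norm v \<le> 1})"
  proof (rule bdd_aboveI2)
    fix v assume v: "v \<in> {v \<in> carrier_vec (dim_col A). vec_norm v \<le> 1}"
    then have "vec_norm (A *\<^sub>v v) \<le> real n * real k * E * vec_norm v"
      using A by (intro vec_norm_mult_mat_vec_le[OF A _ E]) auto
    also have "\<dots> \<le> real n * real k * E * 1"
      using v E0 by (intro mult_left_mono) auto
    finally show "vec_norm (A *\<^sub>v v) \<le> real n * real k * E" by simp
  qed
  show ?thesis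
  proof (cases "vec_norm v = 0")
    case True
    with vec_norm_mult_mat_vec_le[OF A v E] show ?thesis by simp
  next
    case False
    then have pos: "0 < vec_norm v" using vec_norm_nonneg[of v] by simp
    define u where "u = (1 / vec_norm v) \<cdot>\<^sub>v v"
    have u: "u \<in> carrier_vec k" "vec_norm u = 1"
      using v pos by (auto simp: u_def vec_norm_smult)
    then have "vec_norm (A *\<^sub>v u) \<le> spectral_norm A"
      unfolding spectral_norm_def using A by (intro cSUP_upper[OF _ bdd]) auto
    moreover have "A *\<^sub>v u = (1 / vec_norm v) \<cdot>\<^sub>v (A *\<^sub>v v)"
      using A v by (simp add: u_def mult_mat_vec)
    ultimately show ?thesis
      using pos by (simp add: vec_norm_smult field_simps)
  qed
qed

lemma abs_entry_le_spectral_norm: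
  assumes A: "A \<in> carrier_mat n k" and "i < n" "j < k"
  shows "\<bar>A $$ (i, j)\<bar> \<le> spectral_norm A"
proof -
  have "A $$ (i, j) = (A *\<^sub>v unit_vec k j) $ i"
    using assms by (simp add: scalar_prod_right_unit)
  also have "\<bar>\<dots>\<bar> \<le> vec_norm (A *\<^sub>v unit_vec k j)"
    using assms by (intro abs_entry_le_vec_norm) simp
  also have "\<dots> \<le> spectral_norm A * vec_norm (unit_vec k j)"
    using assms by (intro vec_norm_mult_le_spectral_norm) auto
  finally show ?thesis using assms by (simp add: vec_norm_unit_vec)
qed

text \<open>Any vector whose image is much shorter than itself makes the inverse large. The norm of
  \<open>A\<close> itself is bounded below by one entry. Singular matrices are covered by the value
  \<open>\<infinity>\<close> of the condition number.\<close>

lemma cond_number_ge: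
  assumes A: "A \<in> carrier_mat n n" and x: "x \<in> carrier_vec n"
    and "i < n" "j < n" and e: "0 < e" "e \<le> \<bar>A $$ (i, j)\<bar>"
    and a: "a \<le> vec_norm x" and \<delta>: "vec_norm (A *\<^sub>v x) \<le> \<delta>" "0 < \<delta>"
  shows "ereal (e * a / \<delta>) \<le> cond_number A"
proof (cases "mat_inverse A")
  case None
  then show ?thesis by (simp add: cond_number_def)
next
  case (Some B)
  from mat_inverse(2)[OF A Some] have B: "B * A = 1\<^sub>m n" "B \<in> carrier_mat n n" by auto
  have "x = B *\<^sub>v (A *\<^sub>v x)"
    using A B x by (simp flip: assoc_mult_mat_vec)
  moreover have "vec_norm (B *\<^sub>v (A *\<^sub>v x)) \<le> spectral_norm B * vec_norm (A *\<^sub>v x)"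
    using A B x by (intro vec_norm_mult_le_spectral_norm) auto
  moreover have B0: "0 \<le> spectral_norm B"
    using abs_entry_le_spectral_norm[OF B(2) \<open>i < n\<close> \<open>j < n\<close>] by linarith
  then have "spectral_norm B * vec_norm (A *\<^sub>v x) \<le> spectral_norm B * \<delta>"
    using \<delta> by (intro mult_left_mono)
  ultimately have "a \<le> spectral_norm B * \<delta>" using a by simp
  then have "a / \<delta> \<le> spectral_norm B" using \<delta> by (simp add: field_simps)
  then have "e * (a / \<delta>) \<le> e * spectral_norm B" using e by (intro mult_left_mono) auto
  also have "\<dots> \<le> spectral_norm A * spectral_norm B"
    using B0 e abs_entry_le_spectral_norm[OF A \<open>i < n\<close> \<open>j < n\<close>] by (intro mult_right_mono) auto
  finally show ?thesis by (simp add: cond_number_def Some)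
qed

text \<open>An a priori bound on the solutions of \<open>A x = y\<close> gives invertibility and, with unit vectors
  as right-hand sides, bounds the entries of the inverse.\<close>

lemma cond_number_le:
  assumes A: "A \<in> carrier_mat n n"
    and E: "\<And>i j. i < n \<Longrightarrow> j < n \<Longrightarrow> \<bar>A $$ (i, j)\<bar> \<le> E" "0 \<le> E"
    and F: "\<And>x i. x \<in> carrier_vec n \<Longrightarrow> i < n \<Longrightarrow> \<bar>x $ i\<bar> \<le> F * vec_norm (A *\<^sub>v x)" "0 \<le> F"
  shows "cond_number A \<le> ereal (E * F * real n ^ 4)"
proof -
  have "det A \<noteq> 0"
  proof
    assume "det A = 0"
    then obtain x where x: "x \<in> carrier_vec n" "x \<noteq> 0\<^sub>v n" "A *\<^sub>v x = 0\<^sub>v n"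
      using det_0_iff_vec_prod_zero[OF A] by auto
    have "x $ i = 0" if "i < n" for i
      using F(1)[OF x(1) that] x(3) by (simp add: vec_norm_def)
    then have "x = 0\<^sub>v n" using x(1) by (intro eq_vecI) auto
    with x(2) show False ..
  qed
  then have "A \<in> Units (ring_mat TYPE(real) n ())"
    using det_non_zero_imp_unit[OF A] by simp
  with mat_inverse(1)[OF A, where b = "()"] obtain B where Some: "mat_inverse A = Some B"
    by (cases "mat_inverse A") auto
  from mat_inverse(2)[OF A Some] have B: "A * B = 1\<^sub>m n" "B \<in> carrier_mat n n" by auto
  have "\<bar>B $$ (i, j)\<bar> \<le> F" if "i < n" "j < n" for i j
  proof -
    have x: "B *\<^sub>v unit_vec n j \<in> carrier_vec n" using B by simp
    have "A *\<^sub>v (B *\<^sub>v unit_vec n j) = unit_vec n j"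
      using A B by (simp flip: assoc_mult_mat_vec)
    with F(1)[OF x \<open>i < n\<close>] that B show ?thesis
      by (simp add: scalar_prod_right_unit vec_norm_unit_vec)
  qed
  then have "spectral_norm B \<le> real n ^ 2 * F"
    by (intro spectral_norm_le[OF B(2)] F(2)) auto
  moreover have "spectral_norm A \<le> real n ^ 2 * E" by (rule spectral_norm_le[OF A E])
  moreover have "0 \<le> spectral_norm B"
  proof (cases "n = 0")
    case True
    then have "vec_norm (B *\<^sub>v 0\<^sub>v 0) = 0" using B by (simp add: vec_norm_def scalar_prod_def)
    moreover have "{v \<in> carrier_vec (dim_col B). vec_norm v \<le> 1} = {0\<^sub>v 0}"
      using True B by (auto simp: vec_norm_def)
    ultimately show ?thesis unfolding spectral_norm_def by simp
  next
    case False
    then show ?thesis using abs_entry_le_spectral_norm[OF B(2), of 0 0] by linarith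
  qed
  ultimately have "spectral_norm A * spectral_norm B \<le> (real n ^ 2 * E) * (real n ^ 2 * F)"
    using E(2) by (intro mult_mono) auto
  also have "\<dots> = E * F * real n ^ 4" by (simp add: power_numeral_reduce)
  finally show ?thesis by (simp add: cond_number_def Some)
qed

section \<open>Block Toeplitz matrices and power series\<close>

lemma block_lower_toeplitz_carrier:
  "block_lower_toeplitz m A N \<in> carrier_mat (m * N) (m * N)"
  by (simp add: block_lower_toeplitz_def)

text \<open>Generating function of the \<open>b\<close>-th entries of the \<open>N\<close> blocks of \<open>x\<close>. It is cut off
  at \<open>N\<close> because \<open>x $ j\<close> is unspecified beyond the dimension of \<open>x\<close>.\<close>

definition component :: "nat \<Rightarrow> nat \<Rightarrow> nat \<Rightarrow> real vec \<Rightarrow> real fps" where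
  "component m N b x = Abs_fps (\<lambda>j. if j < N then x $ (m * j + b) else 0)"

lemma block_index_less: "a < m \<Longrightarrow> i < N \<Longrightarrow> m * i + a < m * (N::nat)"
proof -
  assume "a < m" "i < N"
  then have "m * i + a < m * Suc i" by simp
  also have "\<dots> \<le> m * N" using \<open>i < N\<close> by (intro mult_le_mono2) auto
  finally show ?thesis .
qed

text \<open>Since the matrix is block lower triangular and Toeplitz, its action is a convolution of block
  sequences, that is, a product of power series.\<close>

lemma block_lower_toeplitz_mult_vec:
  assumes x: "x \<in> carrier_vec (m * N)" and "i < N" "a < m"
  shows "(block_lower_toeplitz m A N *\<^sub>v x) $ (m * i + a) =
         fps_nth (\<Sum>b<m. Abs_fps (\<lambda>k. A k $$ (a, b)) * component m N b x) i"
proof -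
  let ?T = "block_lower_toeplitz m A N"
  have "(?T *\<^sub>v x) $ (m * i + a) = (\<Sum>j<m * N. ?T $$ (m * i + a, j) * x $ j)"
    using x block_index_less[OF \<open>a < m\<close> \<open>i < N\<close>]
    by (simp add: scalar_prod_def atLeast0LessThan block_lower_toeplitz_def)
  also have "\<dots> = (\<Sum>q<N. \<Sum>j\<in>{q * m..<q * m + m}. ?T $$ (m * i + a, j) * x $ j)"
    by (simp add: sum.nat_group mult.commute)
  also have "\<dots> = (\<Sum>q<N. \<Sum>b<m. if q \<le> i then A (i - q) $$ (a, b) * x $ (m * q + b) else 0)"
  proof (rule sum.cong[OF refl])
    fix q assume q: "q \<in> {..<N}"
    have "(\<Sum>j\<in>{q * m..<q * m + m}. ?T $$ (m * i + a, j) * x $ j) =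
          (\<Sum>b<m. ?T $$ (m * i + a, m * q + b) * x $ (m * q + b))"
      by (rule sum.reindex_bij_witness[of _ "\<lambda>b. m * q + b" "\<lambda>j. j - m * q"])
        (auto simp: mult.commute)
    also have "\<dots> = (\<Sum>b<m. if q \<le> i then A (i - q) $$ (a, b) * x $ (m * q + b) else 0)"
      using q \<open>a < m\<close> \<open>i < N\<close>
      by (intro sum.cong) (auto simp: block_lower_toeplitz_def block_index_less)
    finally show "(\<Sum>j\<in>{q * m..<q * m + m}. ?T $$ (m * i + a, j) * x $ j) = \<dots>" .
  qed
  also have "\<dots> = (\<Sum>b<m. \<Sum>q<N. if q \<le> i then A (i - q) $$ (a, b) * x $ (m * q + b) else 0)"
    by (rule sum.swap)
  also have "\<dots> = (\<Sum>b<m. \<Sum>q=0..i. A (i - q) $$ (a, b) * x $ (m * q + b))"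
    using \<open>i < N\<close> by (intro sum.cong sum.mono_neutral_cong_right refl) auto
  also have "\<dots> = (\<Sum>b<m. fps_nth (component m N b x * Abs_fps (\<lambda>k. A k $$ (a, b))) i)"
    using \<open>i < N\<close> by (intro sum.cong refl) (auto simp: fps_mult_nth component_def intro!: sum.cong)
  finally show ?thesis by (simp add: fps_sum_nth mult.commute)
qed


lemma block_lower_toeplitz_mult_vec_poly:
  assumes x: "x \<in> carrier_vec (m * N)" and "i < N" "a < m"
    and sym: "\<And>k a b. a < m \<Longrightarrow> b < m \<Longrightarrow> A k $$ (a, b) = coeff (P a b) k"
  shows "(block_lower_toeplitz m A N *\<^sub>v x) $ (m * i + a) =
         fps_nth (\<Sum>b<m. fps_of_poly (P a b) * component m N b x) i"
proof -
  have "Abs_fps (\<lambda>k. A k $$ (a, b)) = fps_of_poly (P a b)" if "b < m" for b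
    using sym[OF \<open>a < m\<close> that] by (intro fps_ext) simp
  then show ?thesis
    unfolding block_lower_toeplitz_mult_vec[OF assms(1-3)]
    by (intro arg_cong[of _ _ "\<lambda>f. fps_nth f i"] sum.cong) auto
qed

lemma poly_family_coeffs_bounded:
  fixes P :: "nat \<Rightarrow> nat \<Rightarrow> real poly"
  obtains S where "0 \<le> S" "\<And>a b k. a < m \<Longrightarrow> b < m' \<Longrightarrow> \<bar>coeff (P a b) k\<bar> \<le> S"
proof -
  define s where "s a b = (\<Sum>k\<le>degree (P a b). \<bar>coeff (P a b) k\<bar>)" for a b
  have s: "0 \<le> s a b" "\<bar>coeff (P a b) k\<bar> \<le> s a b" for a b k
  proof -
    show nonneg: "0 \<le> s a b" by (auto simp: s_def intro: sum_nonneg)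
    show "\<bar>coeff (P a b) k\<bar> \<le> s a b"
    proof (cases "k \<le> degree (P a b)")
      case True
      then show ?thesis unfolding s_def by (intro member_le_sum) auto
    next
      case False
      then show ?thesis using nonneg by (simp add: coeff_eq_0)
    qed
  qed
  show ?thesis
  proof (rule that)
    show "0 \<le> (\<Sum>a<m. \<Sum>b<m'. s a b)" by (intro sum_nonneg s)
    show "\<bar>coeff (P a b) k\<bar> \<le> (\<Sum>a<m. \<Sum>b<m'. s a b)" if "a < m" "b < m'" for a b k
      by (rule order_trans[OF s(2) member_le_double_sum[OF that s(1)]])
  qed
qed

lemma fps_mult_nth_abs_le:
  fixes f g :: "real fps"
  assumes f: "\<And>k. k \<le> n \<Longrightarrow> \<bar>fps_nth f k\<bar> \<le> a"
    and g: "\<And>k. k \<le> n \<Longrightarrow> \<bar>fps_nth g k\<bar> \<le> b"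
  shows "\<bar>fps_nth (f * g) n\<bar> \<le> real (n + 1) * (a * b)"
proof -
  have "\<bar>fps_nth (f * g) n\<bar> \<le> (\<Sum>k=0..n. \<bar>fps_nth f k\<bar> * \<bar>fps_nth g (n - k)\<bar>)"
    unfolding fps_mult_nth by (rule order_trans[OF sum_abs]) (simp add: abs_mult)
  also have "\<dots> \<le> (\<Sum>k=0..n. a * b)"
  proof (rule sum_mono)
    fix k assume "k \<in> {0..n}"
    then have "\<bar>fps_nth f k\<bar> \<le> a" "\<bar>fps_nth g (n - k)\<bar> \<le> b" using f g by auto
    then show "\<bar>fps_nth f k\<bar> * \<bar>fps_nth g (n - k)\<bar> \<le> a * b" by (intro mult_mono) auto
  qed
  finally show ?thesis by (simp add: add.commute)
qed

text \<open>Here \<open>Q\<close> plays the role of the adjugate of the symbol \<open>P\<close> and \<open>d\<close> that of its determinant.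
  Multiplying the series of \<open>A x\<close> by \<open>Q\<close> decouples the system into scalar equations
  \<open>d X\<^sub>c = W\<^sub>c\<close>, which the reciprocal \<open>V\<close> of \<open>d\<close> solves. Each of the two power series products
  costs a factor \<open>N\<close>, and so does the linear growth of the coefficients of \<open>V\<close>.
  Only coefficients below \<open>N\<close> are involved, so the truncation does no harm.\<close>

lemma block_lower_toeplitz_solution_bound:
  fixes P Q :: "nat \<Rightarrow> nat \<Rightarrow> real poly"
  assumes sym: "\<And>k a b. a < m \<Longrightarrow> b < m \<Longrightarrow> A k $$ (a, b) = coeff (P a b) k"
    and adj: "\<And>c b. c < m \<Longrightarrow> b < m \<Longrightarrow> (\<Sum>a<m. Q c a * P a b) = (if c = b then d else 0)"
    and V: "V * fps_of_poly d = 1" "\<And>n. \<bar>fps_nth V n\<bar> \<le> v * real (n + 1)" and "0 \<le> v"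
  obtains F where "0 \<le> F"
    "\<And>N x j. x \<in> carrier_vec (m * N) \<Longrightarrow> j < m * N \<Longrightarrow>
       \<bar>x $ j\<bar> \<le> F * real N ^ 3 * vec_norm (block_lower_toeplitz m A N *\<^sub>v x)"
proof -
  obtain S where S: "0 \<le> S" "\<And>a b k. a < m \<Longrightarrow> b < m \<Longrightarrow> \<bar>coeff (Q a b) k\<bar> \<le> S"
    using poly_family_coeffs_bounded[of m m Q] by blast
  have "\<bar>x $ j\<bar> \<le> v * m * S * real N ^ 3 * vec_norm (block_lower_toeplitz m A N *\<^sub>v x)"
    if x: "x \<in> carrier_vec (m * N)" and j: "j < m * N" for N x j
  proof -
    define y where "y = block_lower_toeplitz m A N *\<^sub>v x"
    define Y where "Y a = (\<Sum>b<m. fps_of_poly (P a b) * component m N b x)" for a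
    define W where "W c = (\<Sum>a<m. fps_of_poly (Q c a) * Y a)" for c
    define i c where "i = j div m" and "c = j mod m"
    have "0 < m" using j by (cases m) auto
    then have ic: "j = m * i + c" "c < m" "i < N"
      using j by (auto simp: i_def c_def less_mult_imp_div_less mult.commute)
    have y_dim: "dim_vec y = m * N" using block_lower_toeplitz_carrier[of m A N] by (simp add: y_def)
    have Y: "\<bar>fps_nth (Y a) k\<bar> \<le> vec_norm y" if "a < m" "k < N" for a k
      using block_lower_toeplitz_mult_vec_poly[OF x \<open>k < N\<close> \<open>a < m\<close> sym]
        abs_entry_le_vec_norm[of "m * k + a" y] block_index_less[OF that] y_dim
      by (simp add: Y_def y_def)
    have W: "\<bar>fps_nth (W c) k\<bar> \<le> m * (N * (S * vec_norm y))" if "k < N" for k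
    proof -
      have "\<bar>fps_nth (W c) k\<bar> \<le> (\<Sum>a<m. \<bar>fps_nth (fps_of_poly (Q c a) * Y a) k\<bar>)"
        unfolding W_def fps_sum_nth by (rule sum_abs)
      also have "\<dots> \<le> (\<Sum>a<m. N * (S * vec_norm y))"
      proof (rule sum_mono)
        fix a assume a: "a \<in> {..<m}"
        then have "\<bar>fps_nth (fps_of_poly (Q c a) * Y a) k\<bar> \<le> (k + 1) * (S * vec_norm y)"
          using S(2)[OF \<open>c < m\<close>] Y \<open>k < N\<close>
          by (intro fps_mult_nth_abs_le) auto
        also have "\<dots> \<le> N * (S * vec_norm y)"
          using \<open>k < N\<close> S(1) vec_norm_nonneg by (intro mult_right_mono mult_nonneg_nonneg) auto
        finally show "\<bar>fps_nth (fps_of_poly (Q c a) * Y a) k\<bar> \<le> N * (S * vec_norm y)" .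
      qed
      finally show ?thesis by simp
    qed
    have "W c = (\<Sum>a<m. \<Sum>b<m. fps_of_poly (Q c a) * (fps_of_poly (P a b) * component m N b x))"
      by (simp add: W_def Y_def sum_distrib_left)
    also have "\<dots> = (\<Sum>b<m. \<Sum>a<m. fps_of_poly (Q c a) * (fps_of_poly (P a b) * component m N b x))"
      by (rule sum.swap)
    also have "\<dots> = (\<Sum>b<m. fps_of_poly (\<Sum>a<m. Q c a * P a b) * component m N b x)"
      by (simp add: fps_of_poly_sum fps_of_poly_mult sum_distrib_right mult.assoc)
    also have "\<dots> = (\<Sum>b<m. if c = b then fps_of_poly d * component m N b x else 0)"
      using adj ic by (intro sum.cong) auto
    also have "\<dots> = fps_of_poly d * component m N c x"
      using ic by simp
    finally have "V * W c = (V * fps_of_poly d) * component m N c x" by (simp add: mult.assoc)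
    then have "x $ j = fps_nth (V * W c) i"
      using ic V(1) by (simp add: component_def)
    also have "\<bar>\<dots>\<bar> \<le> (i + 1) * ((v * N) * (m * (N * (S * vec_norm y))))"
    proof (rule fps_mult_nth_abs_le)
      fix k assume "k \<le> i"
      then have "v * real (k + 1) \<le> v * N" using \<open>i < N\<close> \<open>0 \<le> v\<close> by (intro mult_left_mono) auto
      then show "\<bar>fps_nth V k\<bar> \<le> v * N" using V(2)[of k] by linarith
    qed (use W \<open>i < N\<close> in auto)
    also have "\<dots> \<le> N * ((v * N) * (m * (N * (S * vec_norm y))))"
      using \<open>i < N\<close> \<open>0 \<le> v\<close> S(1) vec_norm_nonneg by (intro mult_right_mono mult_nonneg_nonneg) auto
    finally show ?thesis by (simp add: y_def power3_eq_cube mult_ac)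
  qed
  with that[of "v * m * S"] S(1) \<open>0 \<le> v\<close> show ?thesis by simp
qed

text \<open>The vector with blocks \<open>r^(N-1-j) w\<close> is annihilated by every block row that sees all
  coefficients of the symbol, because there the convolution evaluates \<open>P(r) w = 0\<close>. The remaining
  rows are the first \<open>D\<close>, where \<open>D\<close> does not depend on \<open>N\<close>, and there the powers of \<open>r\<close> are small.\<close>

lemma block_lower_toeplitz_decaying_image:
  fixes P :: "nat \<Rightarrow> nat \<Rightarrow> real poly"
  assumes sym: "\<And>k a b. a < m \<Longrightarrow> b < m \<Longrightarrow> A k $$ (a, b) = coeff (P a b) k"
    and r: "\<bar>r\<bar> < 1" and ker: "\<And>a. a < m \<Longrightarrow> (\<Sum>b<m. poly (P a b) r * w b) = 0"
  obtains C s where "0 < C" "0 < s" "s < 1"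
    "\<And>N. 1 \<le> N \<Longrightarrow> \<exists>x \<in> carrier_vec (m * N). (\<forall>b<m. x $ (m * (N - 1) + b) = w b) \<and>
       vec_norm (block_lower_toeplitz m A N *\<^sub>v x) \<le> C * s ^ N"
proof -
  define Q where "Q a = (\<Sum>b<m. smult (w b) (P a b))" for a
  have Q_root: "poly (Q a) r = 0" if "a < m" for a
    using ker[OF that] by (simp add: Q_def poly_sum mult.commute)
  define D where "D = Suc (\<Sum>a<m. degree (Q a))"
  have D: "degree (Q a) < D" if "a < m" for a
  proof -
    have "degree (Q a) \<le> (\<Sum>a<m. degree (Q a))" using that by (intro member_le_sum) auto
    then show ?thesis by (simp add: D_def)
  qed
  obtain S where S: "0 \<le> S" "\<And>a k. a < m \<Longrightarrow> \<bar>coeff (Q a) k\<bar> \<le> S"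
    using poly_family_coeffs_bounded[of m 1 "\<lambda>a _. Q a"] by (metis less_one)
  \<comment> \<open>The root \<open>r\<close> may be zero or negative, whereas the rate of decay has to be positive.\<close>
  define s where "s = max \<bar>r\<bar> (1 / 2)"
  have s: "0 < s" "s < 1" "\<bar>r\<bar> \<le> s" using r by (auto simp: s_def)
  define C where "C = (m * D * (D * S) + 1) / s ^ D"
  have "0 \<le> m * D * (D * S)" using S(1) by simp
  then have C: "0 < C" unfolding C_def using s by (intro divide_pos_pos) auto
  have "\<exists>x \<in> carrier_vec (m * N). (\<forall>b<m. x $ (m * (N - 1) + b) = w b) \<and>
       vec_norm (block_lower_toeplitz m A N *\<^sub>v x) \<le> C * s ^ N" if N: "1 \<le> N" for N
  proof -
    define x where "x = vec (m * N) (\<lambda>j. w (j mod m) * r ^ (N - 1 - j div m))"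
    define y where "y = block_lower_toeplitz m A N *\<^sub>v x"
    define G where "G = Abs_fps (\<lambda>j. if j < N then r ^ (N - 1 - j) else 0)"
    have x: "x \<in> carrier_vec (m * N)" by (simp add: x_def)
    have y_dim: "dim_vec y = m * N" using block_lower_toeplitz_carrier[of m A N] by (simp add: y_def)
    have comp: "component m N b x = fps_const (w b) * G" if "b < m" for b
      using that by (intro fps_ext) (auto simp: component_def G_def x_def block_index_less)
    have y: "y $ (m * i + a) = (\<Sum>k=0..i. coeff (Q a) k * r ^ (N - 1 - (i - k)))"
      if "a < m" "i < N" for a i
    proof -
      have "(\<Sum>b<m. fps_of_poly (P a b) * component m N b x) = fps_of_poly (Q a) * G"
        unfolding Q_def fps_of_poly_sum sum_distrib_right
        by (intro sum.cong) (auto simp: comp fps_of_poly_smult mult_ac)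
      then have "y $ (m * i + a) = fps_nth (fps_of_poly (Q a) * G) i"
        using block_lower_toeplitz_mult_vec_poly[OF x \<open>i < N\<close> \<open>a < m\<close>, of A P] sym
        by (simp add: y_def)
      also have "\<dots> = (\<Sum>k=0..i. coeff (Q a) k * r ^ (N - 1 - (i - k)))"
        using \<open>i < N\<close> unfolding fps_mult_nth by (intro sum.cong) (auto simp: G_def)
      finally show ?thesis .
    qed
    have y_zero: "y $ (m * i + a) = 0" if "a < m" "i < N" "D \<le> i" for a i
    proof -
      have "y $ (m * i + a) = (\<Sum>k=0..i. r ^ (N - 1 - i) * (coeff (Q a) k * r ^ k))"
        unfolding y[OF that(1,2)]
      proof (intro sum.cong refl)
        fix k assume "k \<in> {0..i}"
        then have "N - 1 - (i - k) = (N - 1 - i) + k" using \<open>i < N\<close> by auto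
        then show "coeff (Q a) k * r ^ (N - 1 - (i - k)) = r ^ (N - 1 - i) * (coeff (Q a) k * r ^ k)"
          by (simp add: power_add)
      qed
      also have "\<dots> = r ^ (N - 1 - i) * (\<Sum>k\<le>degree (Q a). coeff (Q a) k * r ^ k)"
        unfolding sum_distrib_left[symmetric] using D[OF \<open>a < m\<close>] \<open>D \<le> i\<close>
        by (intro arg_cong[of _ _ "\<lambda>t. r ^ (N - 1 - i) * t"] sum.mono_neutral_right)
          (auto simp: coeff_eq_0)
      also have "\<dots> = 0"
        using Q_root[OF \<open>a < m\<close>] by (simp add: poly_altdef)
      finally show ?thesis .
    qed
    have y_small: "\<bar>y $ (m * i + a)\<bar> \<le> D * S * (s ^ N / s ^ D)" if "a < m" "i < N" "i < D" for a i
    proof -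
      have "\<bar>y $ (m * i + a)\<bar> \<le> (\<Sum>k=0..i. \<bar>coeff (Q a) k\<bar> * \<bar>r\<bar> ^ (N - 1 - (i - k)))"
        unfolding y[OF that(1,2)] by (rule order_trans[OF sum_abs]) (simp add: abs_mult power_abs)
      also have "\<dots> \<le> (\<Sum>k=0..i. S * (s ^ N / s ^ D))"
      proof (rule sum_mono)
        fix k assume k: "k \<in> {0..i}"
        have "\<bar>r\<bar> ^ (N - 1 - (i - k)) \<le> s ^ (N - 1 - (i - k))"
          using s by (intro power_mono) auto
        moreover have "s ^ (N - 1 - (i - k)) * s ^ D \<le> s ^ N"
          unfolding power_add[symmetric] using s k \<open>i < D\<close> \<open>i < N\<close>
          by (intro power_decreasing) auto
        then have "s ^ (N - 1 - (i - k)) \<le> s ^ N / s ^ D" using s by (simp add: field_simps)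
        ultimately show "\<bar>coeff (Q a) k\<bar> * \<bar>r\<bar> ^ (N - 1 - (i - k)) \<le> S * (s ^ N / s ^ D)"
          using S(2)[OF \<open>a < m\<close>, of k] S(1) by (intro mult_mono) auto
      qed
      also have "\<dots> = (i + 1) * (S * (s ^ N / s ^ D))" by simp
      also have "\<dots> \<le> D * (S * (s ^ N / s ^ D))"
        using \<open>i < D\<close> S(1) s by (intro mult_right_mono) auto
      finally show ?thesis by (simp add: mult.assoc)
    qed
    have "vec_norm y \<le> (\<Sum>j<m * N. \<bar>y $ j\<bar>)"
      using vec_norm_le_sum_abs[of y] y_dim by simp
    also have "\<dots> \<le> (\<Sum>j<m * N. if j < m * D then D * S * (s ^ N / s ^ D) else 0)"
    proof (rule sum_mono)
      fix j assume "j \<in> {..<m * N}"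
      then have j: "j < m * N" by simp
      then have "0 < m" by (cases m) auto
      define i a where "i = j div m" and "a = j mod m"
      have ia: "j = m * i + a" "a < m" "i < N" "i < D \<longleftrightarrow> j < m * D"
        using j \<open>0 < m\<close> less_mult_imp_div_less[of j N m]
        by (simp_all add: i_def a_def div_less_iff_less_mult mult.commute)
      show "\<bar>y $ j\<bar> \<le> (if j < m * D then D * S * (s ^ N / s ^ D) else 0)"
      proof (cases "i < D")
        case True
        then show ?thesis using y_small[OF ia(2,3) True] ia(1,4) by simp
      next
        case False
        then show ?thesis using y_zero[OF ia(2,3)] ia(1,4) by simp
      qed
    qed
    also have "\<dots> = (\<Sum>j\<in>{..<m * N} \<inter> {..<m * D}. D * S * (s ^ N / s ^ D))"
      by (subst sum.inter_restrict) auto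
    also have "\<dots> \<le> (\<Sum>j<m * D. D * S * (s ^ N / s ^ D))"
      using S(1) s by (intro sum_mono2) auto
    also have "\<dots> \<le> C * s ^ N"
    proof -
      have "(\<Sum>j<m * D. D * S * (s ^ N / s ^ D)) = (m * D * (D * S)) * (s ^ N / s ^ D)" by simp
      also have "\<dots> \<le> (m * D * (D * S) + 1) * (s ^ N / s ^ D)"
        using s by (intro mult_right_mono) auto
      finally show ?thesis by (simp add: C_def)
    qed
    finally have "vec_norm y \<le> C * s ^ N" .
    moreover have "x $ (m * (N - 1) + b) = w b" if "b < m" for b
      using that N block_index_less[OF that, of "N - 1" N] by (simp add: x_def)
    ultimately show ?thesis using x unfolding y_def by blast
  qed
  then show ?thesis by (rule that[OF C s(1,2)])
qed

section \<open>Palindromic quadratics\<close>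

text \<open>With \<open>c = - q / (2 p)\<close> the coefficients are \<open>U\<^sub>n(c) / p\<close> for the Chebyshev polynomials \<open>U\<^sub>n\<close> of the
  second kind. The hypothesis says \<open>\<bar>c\<bar> \<le> 1\<close>, and the bound \<open>\<bar>U\<^sub>n(c)\<bar> \<le> n + 1\<close> follows from the Pell
  equation \<open>T\<^sub>n\<^sup>2 + (1 - c\<^sup>2) U\<^sub>n\<^sub>-\<^sub>1\<^sup>2 = 1\<close>, which bounds the increments. This argument
  includes the case of a double root \<open>c = \<plusminus>1\<close>.\<close>

lemma reciprocal_palindromic_quadratic_coeffs:
  fixes p q :: real
  assumes "0 < p" "\<bar>q\<bar> \<le> 2 * p"
  obtains V where "V * fps_of_poly [:p, q, p:] = 1" "\<And>n. \<bar>fps_nth V n\<bar> \<le> 1 / p * real (n + 1)"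
proof -
  define c where "c = - q / (2 * p)"
  have "\<bar>c\<bar> \<le> 1" using assms by (simp add: c_def)
  then have c: "c ^ 2 \<le> 1" "q = - 2 * c * p"
    using assms by (simp_all add: c_def abs_square_le_1)
  \<comment> \<open>The iterates are \<open>T\<^sub>n(c)\<close> and \<open>U\<^sub>n\<^sub>-\<^sub>1(c)\<close>: the index of the second one is shifted by one.\<close>
  define step where "step = (\<lambda>(t, u). (c * t - (1 - c ^ 2) * u, t + c * u))"
  define T where "T n = fst ((step ^^ n) (1, 0))" for n
  define U where "U n = snd ((step ^^ n) (1, 0))" for n
  have zero: "T 0 = 1" "U 0 = 0" by (simp_all add: T_def U_def)
  have TU_Suc: "T (Suc n) = c * T n - (1 - c ^ 2) * U n" "U (Suc n) = T n + c * U n" for n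
    by (simp_all add: T_def U_def step_def case_prod_beta)
  have pell: "T n ^ 2 + (1 - c ^ 2) * U n ^ 2 = 1" for n
    by (induction n) (simp_all add: zero TU_Suc, simp add: algebra_simps power2_eq_square)
  have T: "\<bar>T n\<bar> \<le> 1" for n
  proof -
    have "0 \<le> (1 - c ^ 2) * U n ^ 2" using c by simp
    with pell[of n] have "T n ^ 2 \<le> 1" by linarith
    then show ?thesis by (simp add: abs_square_le_1)
  qed
  have U: "\<bar>U n\<bar> \<le> n" for n
  proof (induction n)
    case (Suc n)
    have "\<bar>c * U n\<bar> \<le> 1 * \<bar>U n\<bar>"
      unfolding abs_mult using c by (intro mult_right_mono) (auto simp: abs_square_le_1)
    then have "\<bar>T n + c * U n\<bar> \<le> 1 + real n"
      using Suc.IH T[of n] abs_triangle_ineq[of "T n" "c * U n"] by linarith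
    then show ?case by (simp only: TU_Suc of_nat_Suc add.commute)
  qed (simp add: zero)
  have rec: "U (Suc (Suc n)) = 2 * c * U (Suc n) - U n" for n
    by (simp add: TU_Suc algebra_simps power2_eq_square)
  have one: "U (Suc 0) = 1" by (simp add: TU_Suc zero)
  define V where "V = Abs_fps (\<lambda>n. U (Suc n) / p)"
  show ?thesis
  proof (rule that[of V])
    have coeff: "fps_nth (V * fps_of_poly [:p, q, p:]) n =
        p * fps_nth V n + (if n = 0 then 0 else q * fps_nth V (n - 1)) +
        (if n < 2 then 0 else p * fps_nth V (n - 2))" for n
      by (auto simp: fps_of_poly_pCons distrib_left mult.assoc[symmetric] numeral_2_eq_2)
    have "fps_nth (V * fps_of_poly [:p, q, p:]) n = fps_nth 1 n" for n
    proof -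
      consider "n = 0" | "n = 1" | k where "n = Suc (Suc k)"
        by (metis One_nat_def old.nat.exhaust)
      then show ?thesis
      proof cases
        case 1
        with assms(1) show ?thesis unfolding coeff by (simp add: V_def one)
      next
        case 2
        with assms(1) show ?thesis unfolding coeff by (simp add: V_def one rec zero c(2))
      next
        case 3
        then have "fps_nth (V * fps_of_poly [:p, q, p:]) n =
            U (Suc (Suc (Suc k))) - 2 * c * U (Suc (Suc k)) + U (Suc k)"
          unfolding coeff using assms(1) by (simp add: V_def c(2))
        with 3 show ?thesis by (simp only: rec[of "Suc k"]) simp
      qed
    qed
    then show "V * fps_of_poly [:p, q, p:] = 1" by (intro fps_ext) simp
    show "\<bar>fps_nth V n\<bar> \<le> 1 / p * real (n + 1)" for n
      using U[of "Suc n"] assms(1) by (simp add: V_def field_simps)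
  qed
qed

text \<open>The value at \<open>0\<close> is positive, and the value at \<open>1\<close> or \<open>-1\<close>, depending on the sign of \<open>q\<close>, is
  negative.\<close>

lemma palindromic_quadratic_root_in_unit_disc:
  fixes p q :: real
  assumes "0 < p" "2 * p < \<bar>q\<bar>"
  obtains r where "\<bar>r\<bar> < 1" "poly [:p, q, p:] r = 0"
proof (cases "q < 0")
  case True
  then have "poly [:p, q, p:] 1 < 0" "0 < poly [:p, q, p:] 0" using assms by auto
  from poly_IVT_neg[OF _ this(2,1)] obtain r where "0 < r" "r < 1" "poly [:p, q, p:] r = 0" by auto
  then show ?thesis using that[of r] by auto
next
  case False
  then have "poly [:p, q, p:] (-1) < 0" "0 < poly [:p, q, p:] 0" using assms by auto
  from poly_IVT_pos[OF _ this] obtain r where "-1 < r" "r < 0" "poly [:p, q, p:] r = 0" by auto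
  then show ?thesis using that[of r] by auto
qed

section \<open>The determinant of the symbol\<close>

text \<open>Taking the indices cyclically modulo \<open>3\<close> builds the sign of the cofactor into the order of
  the rows and columns.\<close>

definition cofactor3 :: "(nat \<Rightarrow> nat \<Rightarrow> 'a::comm_ring_1) \<Rightarrow> nat \<Rightarrow> nat \<Rightarrow> 'a" where
  "cofactor3 P a b =
     P ((a + 1) mod 3) ((b + 1) mod 3) * P ((a + 2) mod 3) ((b + 2) mod 3) -
     P ((a + 1) mod 3) ((b + 2) mod 3) * P ((a + 2) mod 3) ((b + 1) mod 3)"

definition det3 :: "(nat \<Rightarrow> nat \<Rightarrow> 'a::comm_ring_1) \<Rightarrow> 'a" where
  "det3 P = (\<Sum>b<3. P 0 b * cofactor3 P 0 b)"

lemma less_3_cases: "a < 3 \<longleftrightarrow> a = 0 \<or> a = 1 \<or> a = (2::nat)"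
  by auto

lemma sum_less_3: "(\<Sum>a<3. f a) = f 0 + f 1 + f (2::nat)"
  by (simp add: numeral_3_eq_3 numeral_2_eq_2)

lemma cofactor3_column_expansion:
  "c < 3 \<Longrightarrow> b < 3 \<Longrightarrow> (\<Sum>a<3. cofactor3 P a c * P a b) = (if c = b then det3 P else 0)"
  unfolding less_3_cases sum_less_3 det3_def cofactor3_def
  by (auto simp: numeral_2_eq_2 algebra_simps)

lemma cofactor3_row_expansion:
  "a < 3 \<Longrightarrow> (\<Sum>b<3. P a b * cofactor3 P 0 b) = (if a = 0 then det3 P else 0)"
  unfolding less_3_cases sum_less_3 det3_def cofactor3_def
  by (auto simp: numeral_2_eq_2 algebra_simps)

definition K_block :: "real \<Rightarrow> nat \<Rightarrow> real mat" where
  "K_block \<rho> k = - stiffness_block k + \<rho> \<cdot>\<^sub>m mass_block k"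

text \<open>The common denominator \<open>140\<close> of the mass blocks is factored out; the stiffness entries are
  accordingly multiplied by \<open>140 * 3 / 10 = 42\<close>.\<close>

definition K_symbol :: "real \<Rightarrow> nat \<Rightarrow> nat \<Rightarrow> real poly" where
  "K_symbol \<rho> a b = smult (1 / 140) (
     [[[:126 + 10 * \<rho>, 84 + 4 * \<rho>:], [:84 + 4 * \<rho>, 126 + 10 * \<rho>:], [:42 + \<rho>, -504 + 40 * \<rho>, 42 + \<rho>:]],
      [[:-168 + 12 * \<rho>:], [:-42 + 9 * \<rho>:], [:84 + 4 * \<rho>, 126 + 10 * \<rho>:]],
      [[:-42 + 9 * \<rho>:], [:-168 + 12 * \<rho>:], [:126 + 10 * \<rho>, 84 + 4 * \<rho>:]]] ! a ! b)"

lemma block_dims [simp]: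
  "dim_row (stiffness_block k) = 3" "dim_col (stiffness_block k) = 3"
  "dim_row (mass_block k) = 3" "dim_col (mass_block k) = 3"
  by (auto simp: stiffness_block_def mass_block_def mat_of_rows_list_def)

lemma K_matrix_eq_block_lower_toeplitz:
  "K_matrix N \<rho> = block_lower_toeplitz 3 (K_block \<rho>) N"
  unfolding K_matrix_def stiffness_matrix_def mass_matrix_def
  by (intro eq_matI) (auto simp: block_lower_toeplitz_def K_block_def)

lemma K_block_eq_coeff_K_symbol:
  "a < 3 \<Longrightarrow> b < 3 \<Longrightarrow> K_block \<rho> k $$ (a, b) = coeff (K_symbol \<rho> a b) k"
proof -
  assume ab: "a < 3" "b < 3"
  consider "k = 0" | "k = 1" | "k = 2" | l where "k = Suc (Suc (Suc l))"
    by (metis One_nat_def numeral_2_eq_2 old.nat.exhaust)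
  then show ?thesis
    using ab unfolding less_3_cases
    by cases (auto simp: K_block_def K_symbol_def stiffness_block_def mass_block_def
        mat_of_rows_list_def numeral_2_eq_2 field_simps)
qed

text \<open>Outer and middle coefficients of the determinant of the symbol, without the constant factor
  of lemma \<open>det3_K_symbol\<close>.\<close>

definition K_det_end :: "real \<Rightarrow> real" where
  "K_det_end \<rho> = \<rho> ^ 3 + 30 * \<rho> ^ 2 + 1080 * \<rho> + 25200"

definition K_det_mid :: "real \<Rightarrow> real" where
  "K_det_mid \<rho> = 8 * \<rho> ^ 3 - 1080 * \<rho> ^ 2 + 23040 * \<rho> - 50400"

lemma det3_K_symbol:
  "det3 (K_symbol \<rho>) = smult (147 / 140 ^ 3) [:K_det_end \<rho>, K_det_mid \<rho>, K_det_end \<rho>:]"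
  unfolding det3_def cofactor3_def sum_less_3 K_symbol_def K_det_end_def K_det_mid_def
  by (simp add: numeral_2_eq_2 field_simps power2_eq_square power3_eq_cube)

lemma K_det_end_pos: "0 < \<rho> \<Longrightarrow> 0 < K_det_end \<rho>"
  by (auto simp: K_det_end_def intro!: add_pos_pos)

text \<open>The next two factorisations give the determinant at \<open>z = 1\<close> and \<open>z = -1\<close>; their real roots are
  the end points of the intervals in the theorem.\<close>

lemma K_det_at_plus_one:
  "2 * K_det_end \<rho> + K_det_mid \<rho> = 10 * \<rho> * (\<rho> - 42) * (\<rho> - 60)"
  by (simp add: K_det_end_def K_det_mid_def algebra_simps power2_eq_square power3_eq_cube)

lemma K_det_at_minus_one:
  "2 * K_det_end \<rho> - K_det_mid \<rho> =
     6 * (10 - \<rho>) * (\<rho> - (90 - 2 * sqrt 1605)) * (\<rho> - (90 + 2 * sqrt 1605))"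
proof -
  have "(\<rho> - (90 - 2 * sqrt 1605)) * (\<rho> - (90 + 2 * sqrt 1605)) = (\<rho> - 90) ^ 2 - 4 * (sqrt 1605) ^ 2"
    by (simp add: algebra_simps power2_eq_square)
  also have "\<dots> = \<rho> ^ 2 - 180 * \<rho> + 1680" by (simp add: power2_eq_square algebra_simps)
  finally show ?thesis
    by (simp only: mult.assoc) (simp add: K_det_end_def K_det_mid_def algebra_simps power2_eq_square power3_eq_cube)
qed

lemma sqrt_1605_bounds: "40 < sqrt 1605" "sqrt 1605 < 41"
  by (auto intro: real_less_rsqrt real_less_lsqrt)

lemma K_det_mid_large:
  assumes "\<rho> > 0" "\<rho> \<in> {90 - 2 * sqrt 1605<..<10} \<union> {42<..<60} \<union> {90 + 2 * sqrt 1605<..}"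
  shows "2 * K_det_end \<rho> < \<bar>K_det_mid \<rho>\<bar>"
proof -
  note s = sqrt_1605_bounds
  consider "\<rho> \<in> {42<..<60}" | "90 - 2 * sqrt 1605 < \<rho>" "\<rho> < 10" | "90 + 2 * sqrt 1605 < \<rho>"
    using assms by auto
  then show ?thesis
  proof cases
    case 1
    then have "10 * \<rho> * (\<rho> - 42) * (\<rho> - 60) < 0" by (intro mult_pos_neg mult_pos_pos) auto
    then show ?thesis using K_det_at_plus_one[of \<rho>] by linarith
  next
    case 2
    then have "6 * (10 - \<rho>) * (\<rho> - (90 - 2 * sqrt 1605)) * (\<rho> - (90 + 2 * sqrt 1605)) < 0"
      using s by (intro mult_pos_neg mult_pos_pos) auto
    then show ?thesis using K_det_at_minus_one[of \<rho>] by linarith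
  next
    case 3
    then have "6 * (10 - \<rho>) * (\<rho> - (90 - 2 * sqrt 1605)) * (\<rho> - (90 + 2 * sqrt 1605)) < 0"
      using s by (intro mult_neg_pos mult_pos_neg) auto
    then show ?thesis using K_det_at_minus_one[of \<rho>] by linarith
  qed
qed

lemma K_det_mid_small:
  assumes "\<rho> > 0" "\<rho> \<in> {0<..90 - 2 * sqrt 1605} \<union> {10..42} \<union> {60..90 + 2 * sqrt 1605}"
  shows "\<bar>K_det_mid \<rho>\<bar> \<le> 2 * K_det_end \<rho>"
proof -
  note s = sqrt_1605_bounds
  consider "\<rho> \<le> 90 - 2 * sqrt 1605" | "10 \<le> \<rho>" "\<rho> \<le> 42" | "60 \<le> \<rho>" "\<rho> \<le> 90 + 2 * sqrt 1605"
    using assms by auto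
  then have "0 \<le> (\<rho> * ((42 - \<rho>) * (60 - \<rho>))) * 10 \<and>
    0 \<le> ((10 - \<rho>) * (\<rho> - (90 - 2 * sqrt 1605))) * (\<rho> - (90 + 2 * sqrt 1605)) * 6"
  proof cases
    case 1
    with s assms(1) show ?thesis
      by (intro conjI mult_nonneg_nonneg mult_nonpos_nonpos mult_nonneg_nonpos) auto
  next
    case 2
    with s show ?thesis
      by (intro conjI mult_nonneg_nonneg mult_nonpos_nonpos mult_nonpos_nonneg) auto
  next
    case 3
    with s have "0 \<le> (42 - \<rho>) * (60 - \<rho>)" by (intro mult_nonpos_nonpos) auto
    moreover have "0 \<le> (10 - \<rho>) * (\<rho> - (90 - 2 * sqrt 1605)) * (\<rho> - (90 + 2 * sqrt 1605))"
      using 3 s by (intro mult_nonpos_nonpos mult_nonpos_nonneg) auto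
    ultimately show ?thesis using assms(1) by auto
  qed
  then have "0 \<le> 10 * \<rho> * (\<rho> - 42) * (\<rho> - 60) \<and>
    0 \<le> 6 * (10 - \<rho>) * (\<rho> - (90 - 2 * sqrt 1605)) * (\<rho> - (90 + 2 * sqrt 1605))"
    by (simp only: mult_ac minus_diff_eq[of 42 \<rho>, symmetric] minus_diff_eq[of 60 \<rho>, symmetric] minus_mult_minus)
  then show ?thesis using K_det_at_plus_one[of \<rho>] K_det_at_minus_one[of \<rho>] by linarith
qed

section \<open>Growth of the condition numbers\<close>

text \<open>The kernel vector of the symbol at the root consists of the cofactors of its first row. The
  values \<open>10\<close> and \<open>42\<close> are excluded because the last of these cofactors vanishes there.\<close>

lemma cond_number_K_matrix_exponential:
  assumes "0 < \<rho>" "2 * K_det_end \<rho> < \<bar>K_det_mid \<rho>\<bar>" "\<rho> \<noteq> 10" "\<rho> \<noteq> 42"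
  shows "\<exists>c \<alpha> :: real. c > 0 \<and> \<alpha> > 0 \<and>
    (\<forall>N::nat. N \<ge> 1 \<longrightarrow> ereal (c * exp (\<alpha> * real (3 * N))) \<le> cond_number (K_matrix N \<rho>))"
proof -
  obtain r where r: "\<bar>r\<bar> < 1" "poly [:K_det_end \<rho>, K_det_mid \<rho>, K_det_end \<rho>:] r = 0"
    using palindromic_quadratic_root_in_unit_disc[OF K_det_end_pos[OF assms(1)] assms(2)] .
  define w where "w b = poly (cofactor3 (K_symbol \<rho>) 0 b) r" for b
  have ker: "(\<Sum>b<3. poly (K_symbol \<rho> a b) r * w b) = 0" if "a < 3" for a
  proof -
    have "(\<Sum>b<3. poly (K_symbol \<rho> a b) r * w b) =
          poly (\<Sum>b<3. K_symbol \<rho> a b * cofactor3 (K_symbol \<rho>) 0 b) r"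
      by (simp add: w_def poly_sum)
    also have "\<dots> = 0"
      using r(2) by (simp add: cofactor3_row_expansion[OF that] det3_K_symbol del: poly_pCons smult_pCons)
    finally show ?thesis .
  qed
  have "w 2 = 63 * (\<rho> - 10) * (\<rho> - 42) / 140 ^ 2"
    by (simp add: w_def cofactor3_def K_symbol_def numeral_2_eq_2 field_simps)
  then have w2: "w 2 \<noteq> 0" using assms(3,4) by (simp only:) simp
  obtain C s where C: "0 < C" "0 < s" "s < 1" and small:
    "\<And>N. 1 \<le> N \<Longrightarrow> \<exists>x \<in> carrier_vec (3 * N). (\<forall>b<3. x $ (3 * (N - 1) + b) = w b) \<and>
       vec_norm (block_lower_toeplitz 3 (K_block \<rho>) N *\<^sub>v x) \<le> C * s ^ N"
    using block_lower_toeplitz_decaying_image[OF K_block_eq_coeff_K_symbol r(1) ker] by blast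
  \<comment> \<open>The entry in the upper left corner, which is positive for every \<open>\<rho> > 0\<close>.\<close>
  define e where "e = (126 + 10 * \<rho>) / 140"
  define \<alpha> where "\<alpha> = - ln s / 3"
  have bound: "ereal (e * \<bar>w 2\<bar> / C * exp (\<alpha> * real (3 * N))) \<le> cond_number (K_matrix N \<rho>)"
    if N: "1 \<le> N" for N
  proof -
    from small[OF N] obtain x where x: "x \<in> carrier_vec (3 * N)"
      "vec_norm (K_matrix N \<rho> *\<^sub>v x) \<le> C * s ^ N"
      and last_block: "\<forall>b<3. x $ (3 * (N - 1) + b) = w b"
      unfolding K_matrix_eq_block_lower_toeplitz by blast
    have "x $ (3 * (N - 1) + 2) = w 2" using last_block by (rule allE[of _ 2]) simp
    then have "\<bar>w 2\<bar> \<le> vec_norm x"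
      using abs_entry_le_vec_norm[of "3 * (N - 1) + 2" x] x N by auto
    moreover have "K_matrix N \<rho> $$ (0, 0) = e"
      using N by (simp add: K_matrix_eq_block_lower_toeplitz block_lower_toeplitz_def
          K_block_eq_coeff_K_symbol K_symbol_def e_def)
    moreover have "0 < e" using assms(1) by (simp add: e_def)
    moreover have "K_matrix N \<rho> \<in> carrier_mat (3 * N) (3 * N)"
      unfolding K_matrix_eq_block_lower_toeplitz by (rule block_lower_toeplitz_carrier)
    ultimately have "ereal (e * \<bar>w 2\<bar> / (C * s ^ N)) \<le> cond_number (K_matrix N \<rho>)"
      using x C N by (intro cond_number_ge[where i = 0 and j = 0]) auto
    moreover have "exp (\<alpha> * real (3 * N)) = 1 / s ^ N"
    proof -
      have "exp (\<alpha> * real (3 * N)) = exp (real N * (- ln s))" by (simp add: \<alpha>_def mult.commute)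
      also have "\<dots> = inverse s ^ N"
        unfolding exp_of_nat_mult using C by (simp add: exp_minus)
      finally show ?thesis by (simp add: power_inverse divide_inverse)
    qed
    ultimately show ?thesis by simp
  qed
  have "0 < e * \<bar>w 2\<bar> / C" "0 < \<alpha>"
    using assms(1) w2 C by (simp_all add: e_def \<alpha>_def)
  with bound show ?thesis by blast
qed

text \<open>The exponent \<open>7\<close> adds the \<open>N^3\<close> of the solution bound and the \<open>n^4\<close> lost in passing
  from entries to spectral norms.\<close>

lemma cond_number_K_matrix_polynomial:
  assumes "0 < \<rho>" "\<bar>K_det_mid \<rho>\<bar> \<le> 2 * K_det_end \<rho>"
  shows "\<exists>\<nu> C :: real. \<forall>\<^sub>F N in sequentially.
    cond_number (K_matrix N \<rho>) \<le> ereal (C * real (3 * N) powr \<nu>)"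
proof -
  define t :: real where "t = 147 / 140 ^ 3"
  have "0 < t" by (simp add: t_def)
  have "0 < t * K_det_end \<rho>" "\<bar>t * K_det_mid \<rho>\<bar> \<le> 2 * (t * K_det_end \<rho>)"
    using K_det_end_pos[OF assms(1)] assms(2) \<open>0 < t\<close> by (simp_all add: abs_mult)
  then obtain V where V: "V * fps_of_poly (det3 (K_symbol \<rho>)) = 1"
    "\<And>n. \<bar>fps_nth V n\<bar> \<le> 1 / (t * K_det_end \<rho>) * real (n + 1)"
    using reciprocal_palindromic_quadratic_coeffs[of "t * K_det_end \<rho>" "t * K_det_mid \<rho>"]
    by (auto simp: det3_K_symbol t_def)
  obtain F where F: "0 \<le> F"
    "\<And>N x j. x \<in> carrier_vec (3 * N) \<Longrightarrow> j < 3 * N \<Longrightarrow>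
       \<bar>x $ j\<bar> \<le> F * real N ^ 3 * vec_norm (K_matrix N \<rho> *\<^sub>v x)"
    using block_lower_toeplitz_solution_bound[OF K_block_eq_coeff_K_symbol
        cofactor3_column_expansion V] \<open>0 < t * K_det_end \<rho>\<close>
    unfolding K_matrix_eq_block_lower_toeplitz by auto
  obtain E where E: "0 \<le> E" "\<And>a b k. a < 3 \<Longrightarrow> b < 3 \<Longrightarrow> \<bar>coeff (K_symbol \<rho> a b) k\<bar> \<le> E"
    using poly_family_coeffs_bounded[of 3 3 "K_symbol \<rho>"] by blast
  have "cond_number (K_matrix N \<rho>) \<le> ereal (E * F * real (3 * N) powr 7)" if "1 \<le> N" for N
  proof -
    have "\<bar>K_matrix N \<rho> $$ (i, j)\<bar> \<le> E" if "i < 3 * N" "j < 3 * N" for i j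
      using that E by (auto simp: K_matrix_eq_block_lower_toeplitz block_lower_toeplitz_def
          K_block_eq_coeff_K_symbol)
    moreover have "K_matrix N \<rho> \<in> carrier_mat (3 * N) (3 * N)"
      unfolding K_matrix_eq_block_lower_toeplitz by (rule block_lower_toeplitz_carrier)
    ultimately have "cond_number (K_matrix N \<rho>) \<le> ereal (E * (F * real N ^ 3) * real (3 * N) ^ 4)"
      using E(1) F by (intro cond_number_le) auto
    also have "E * (F * real N ^ 3) * real (3 * N) ^ 4 \<le> E * (F * real (3 * N) ^ 3) * real (3 * N) ^ 4"
      using E(1) F(1) by (intro mult_left_mono mult_right_mono power_mono) auto
    also have "\<dots> = E * F * real (3 * N) powr 7"
      using that by (simp add: powr_numeral power_mult_distrib power_numeral_reduce)
    finally show ?thesis by simp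
  qed
  then have "\<forall>\<^sub>F N in sequentially. cond_number (K_matrix N \<rho>) \<le> ereal (E * F * real (3 * N) powr 7)"
    by (rule eventually_sequentiallyI)
  then show ?thesis by blast
qed

theorem corollary5p5:
  fixes \<rho> :: real
  assumes "\<rho> > 0"
  shows "(\<rho> \<in> {90 - 2 * sqrt 1605<..<10} \<union> {42<..<60} \<union> {90 + 2 * sqrt 1605<..} \<longrightarrow>
           (\<exists>c \<alpha> :: real. c > 0 \<and> \<alpha> > 0 \<and>
             (\<forall>N::nat. N \<ge> 1 \<longrightarrow>
               ereal (c * exp (\<alpha> * real (3 * N))) \<le> cond_number (K_matrix N \<rho>))))
       \<and> (\<rho> \<in> {0<..90 - 2 * sqrt 1605} \<union> {10..42} \<union> {60..90 + 2 * sqrt 1605} \<longrightarrow>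
           (\<exists>\<nu> C :: real. \<forall>\<^sub>F N in sequentially.
               cond_number (K_matrix N \<rho>) \<le> ereal (C * real (3 * N) powr \<nu>)))"
proof (intro conjI impI)
  assume \<rho>: "\<rho> \<in> {90 - 2 * sqrt 1605<..<10} \<union> {42<..<60} \<union> {90 + 2 * sqrt 1605<..}"
  have "\<rho> \<noteq> 10" "\<rho> \<noteq> 42" using \<rho> sqrt_1605_bounds by auto
  with K_det_mid_large[OF assms \<rho>] show
    "\<exists>c \<alpha> :: real. c > 0 \<and> \<alpha> > 0 \<and>
      (\<forall>N::nat. N \<ge> 1 \<longrightarrow>
        ereal (c * exp (\<alpha> * real (3 * N))) \<le> cond_number (K_matrix N \<rho>))"
    by (intro cond_number_K_matrix_exponential[OF assms])
next
  assume \<rho>: "\<rho> \<in> {0<..90 - 2 * sqrt 1605} \<union> {10..42} \<union> {60..90 + 2 * sqrt 1605}"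
  show "\<exists>\<nu> C :: real. \<forall>\<^sub>F N in sequentially.
      cond_number (K_matrix N \<rho>) \<le> ereal (C * real (3 * N) powr \<nu>)"
    by (rule cond_number_K_matrix_polynomial[OF assms K_det_mid_small[OF assms \<rho>]])
qed

end
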